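(* For $m\ge2$, let $G=K_{a_1,a_2,\ldots,a_m}$ be a complete $m$-partite graph of order $n=\sum_{i=1}^m a_i\ge3$ (with partite sets of sizes $a_1,\ldots,a_m\ge1$), and let $s$ be the number of partite sets of $G$ consisting of exactly one element. Then, for every real $k\in[1,2]$, $$\dim_f^k(G)=k\dim_f(G)=\begin{cases}\frac{k(n-1)}{2} & \text{if } s=1,\\ \frac{kn}{2} & \text{otherwise}.\end{cases}$$
   Context: For a finite simple connected graph $G$ with at least two vertices, $d(x,y)$ is the length of a shortest path between $x$ and $y$. For distinct $x,y\in V(G)$, let $R\{x,y\}=\{z\in V(G): d(x,z)\neq d(y,z)\}$, and let $\kappa(G)=\min\{|R\{x,y\}|: x\neq y,\ x,y\in V(G)\}$. For a function $g$ on $V(G)$ and $U\subseteq V(G)$, write $g(U)=\sum_{s\in U}g(s)$. For a real number $k\in[1,\kappa(G)]$, a function $g:V(G)\to[0,1]$ is a $k$-resolving function of $G$ if $g(R\{x,y\})\ge k$ for any two distinct vertices $x,y\in V(G)$; the fractional $k$-metric dimension is $\dim_f^k(G)=\min\{g(V(G)): g \text{ is a } k\text{-resolving function of } G\}$. The fractional metric dimension is $\dim_f(G)=\dim_f^1(G)$. *)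

theory Defs
  imports Complex_Main "Graph_Theory.Graph_Theory"
begin

text \<open>
  A finite simple graph is a \<^const>\<open>pair_graph\<close>: each undirected edge xy is represented by the
  two arcs (x, y) and (y, x).
\<close>

text \<open>A path is represented by its list of arcs, so the length of that list is its number of edges.\<close>

definition graph_dist :: "'a pair_pre_digraph \<Rightarrow> 'a \<Rightarrow> 'a \<Rightarrow> nat" where
  "graph_dist G x y = (LEAST l. \<exists>p. pre_digraph.apath G x p y \<and> length p = l)"

definition resolving_set :: "'a pair_pre_digraph \<Rightarrow> 'a \<Rightarrow> 'a \<Rightarrow> 'a set" where
  "resolving_set G x y = {z \<in> pverts G. graph_dist G x z \<noteq> graph_dist G y z}"

definition kappa :: "'a pair_pre_digraph \<Rightarrow> nat" where
  "kappa G = Min {card (resolving_set G x y) | x y. x \<in> pverts G \<and> y \<in> pverts G \<and> x \<noteq> y}"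

text \<open>
  The admissible range of k is built into the definition, so for other k no function counts
  as k-resolving. Values of g outside the vertex set are irrelevant.
\<close>

definition k_resolving :: "'a pair_pre_digraph \<Rightarrow> real \<Rightarrow> ('a \<Rightarrow> real) \<Rightarrow> bool" where
  "k_resolving G k g \<longleftrightarrow>
     1 \<le> k \<and> k \<le> real (kappa G) \<and>
     (\<forall>v \<in> pverts G. 0 \<le> g v \<and> g v \<le> 1) \<and>
     (\<forall>x \<in> pverts G. \<forall>y \<in> pverts G. x \<noteq> y \<longrightarrow> k \<le> sum g (resolving_set G x y))"

text \<open>
  \<^const>\<open>Least\<close> on the reals is a genuine minimum; it is unspecified (and not an infimum) when
  no minimizer exists.
\<close>

definition frac_k_metric_dim :: "real \<Rightarrow> 'a pair_pre_digraph \<Rightarrow> real" where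
  "frac_k_metric_dim k G = (LEAST r. \<exists>g. k_resolving G k g \<and> r = sum g (pverts G))"

definition frac_metric_dim :: "'a pair_pre_digraph \<Rightarrow> real" where
  "frac_metric_dim G = frac_k_metric_dim 1 G"

definition complete_multipartite :: "nat \<Rightarrow> (nat \<Rightarrow> nat) \<Rightarrow> 'a pair_pre_digraph \<Rightarrow> bool" where
  "complete_multipartite m a G \<longleftrightarrow> pair_graph G \<and>
     (\<exists>P. pverts G = (\<Union>i\<in>{1..m}. P i) \<and>
          disjoint_family_on P {1..m} \<and>
          (\<forall>i\<in>{1..m}. 1 \<le> a i \<and> card (P i) = a i) \<and>
          parcs G = {(u, v). \<exists>i\<in>{1..m}. \<exists>j\<in>{1..m}. i \<noteq> j \<and> u \<in> P i \<and> v \<in> P j})"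

end

theory Submission
  imports Defs
begin

text \<open>
  Two distinct vertices of the same partite set \<open>P i\<close> are twins, so they are resolved only by
  themselves; vertices of \<open>P i\<close> and \<open>P j\<close> with \<open>i \<noteq> j\<close> are resolved exactly by \<open>P i \<union> P j\<close>.
  Averaging the twin constraints over all pairs in a partite set of size at least two gives
  weight at least \<open>k / 2\<close> per vertex there, and averaging over all pairs of singleton partite
  sets does the same for those, unless there is exactly one of them. The
  constant function \<open>k / 2\<close>, set to \<open>0\<close> on a unique singleton partite set, attains the bound.
\<close>

section \<open>Averaging pairwise inequalities\<close>

text \<open>Summing the constraints over all ordered pairs counts each \<open>h x\<close> exactly
  \<open>2 * (card A - 1)\<close> times. A one-element \<open>A\<close> has no pairs and is
  excluded; for \<open>card A = 0\<close> both sides vanish.\<close>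

lemma sum_lower_bound_if_pairwise:
  fixes h :: "'b \<Rightarrow> real"
  assumes "finite A" "card A \<noteq> 1"
    and pair: "\<And>x y. x \<in> A \<Longrightarrow> y \<in> A \<Longrightarrow> x \<noteq> y \<Longrightarrow> k \<le> h x + h y"
  shows "k * real (card A) / 2 \<le> sum h A"
proof (cases "card A = 0")
  case True
  with assms show ?thesis by simp
next
  case False
  define c where "c = real (card A)"
  have c: "c > 1" using False assms(2) by (simp add: c_def)
  \<comment> \<open>For fixed \<open>x\<close>, the \<open>c - 1\<close> partners contribute
    \<open>(c - 1) * h x\<close> plus the sum over \<open>A - {x}\<close>; completing that sum to
    \<open>A\<close> costs one \<open>h x\<close>.\<close>
  have row: "k * (c - 1) \<le> (c - 2) * h x + sum h A" if "x \<in> A" for x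
  proof -
    have "(\<Sum>y\<in>A-{x}. k) \<le> (\<Sum>y\<in>A-{x}. h x + h y)"
      using pair that by (intro sum_mono) auto
    moreover have "real (card (A - {x})) = c - 1"
      using that False assms(1) by (simp add: c_def of_nat_diff Suc_le_eq card_gt_0_iff)
    moreover have "sum h (A - {x}) = sum h A - h x"
      using that assms(1) by (simp add: sum_diff1)
    ultimately show ?thesis
      by (simp add: sum.distrib algebra_simps)
  qed
  have "(\<Sum>x\<in>A. k * (c - 1)) \<le> (\<Sum>x\<in>A. (c - 2) * h x + sum h A)"
    by (intro sum_mono row)
  then have "c * (k * (c - 1)) \<le> (c - 2) * sum h A + c * sum h A"
    by (simp add: sum.distrib c_def flip: sum_distrib_left)
  then have "(c - 1) * (k * c) \<le> (c - 1) * (2 * sum h A)"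
    by (simp add: algebra_simps)
  then have "k * c \<le> 2 * sum h A"
    using c by simp
  then show ?thesis by (simp add: c_def)
qed

section \<open>Shortest-path distances\<close>

lemma graph_dist_le:
  fixes G :: "'a pair_pre_digraph"
  assumes "pre_digraph.apath G x p y"
  shows "graph_dist G x y \<le> length p"
  using assms
  unfolding graph_dist_def by (blast intro: Least_le)

text \<open>\<open>LEAST\<close> is an attained minimum only if some path exists, so a path is
  assumed here and wherever a distance value is turned back into a path.\<close>

lemma graph_dist_witness:
  fixes G :: "'a pair_pre_digraph"
  assumes "pre_digraph.apath G x p y"
  obtains q where "pre_digraph.apath G x q y" "length q = graph_dist G x y"
  using LeastI[of "\<lambda>l. \<exists>p. pre_digraph.apath G x p y \<and> length p = l" "length p"] assms
  unfolding graph_dist_def by blast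

lemma graph_dist_self:
  assumes "x \<in> pverts G"
  shows "graph_dist G x x = 0"
  using graph_dist_le[of G x "[]" x] assms by (simp add: pre_digraph.apath_def pre_digraph.awalk_def
      pre_digraph.awalk_verts.simps pre_digraph.cas.simps)

context pair_wf_digraph
begin

lemma graph_dist_eq_0D: "apath x p y \<Longrightarrow> graph_dist G x y = 0 \<Longrightarrow> x = y"
  by (erule graph_dist_witness) (simp add: apath_Nil_iff)

lemma graph_dist_eq_1D:
  assumes "apath x p y" "graph_dist G x y = 1"
  shows "(x, y) \<in> parcs G"
proof -
  obtain q where "apath x q y" "length q = 1"
    using assms graph_dist_witness by metis
  then show ?thesis
    by (cases q) (auto simp: apath_simps)
qed

lemma graph_dist_adjacent:
  assumes "(x, y) \<in> parcs G" "x \<noteq> y"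
  shows "graph_dist G x y = 1"
proof -
  have "apath x [(x, y)] y"
    using assms by (auto simp: apath_simps dest: in_arcsD2)
  then show ?thesis
    using graph_dist_le[of G x "[(x, y)]" y] graph_dist_eq_0D[of x "[(x, y)]" y] assms
    by fastforce
qed

text \<open>The path through \<open>z\<close> gives at most 2; distance 0 would identify the ends
  and distance 1 would require the missing arc.\<close>

lemma graph_dist_common_neighbour:
  assumes "(x, z) \<in> parcs G" "(z, y) \<in> parcs G" "(x, y) \<notin> parcs G" "distinct [x, z, y]"
  shows "graph_dist G x y = 2"
proof -
  let ?p = "[(x, z), (z, y)]"
  have p: "apath x ?p y"
    using assms by (auto simp: apath_simps dest: in_arcsD2)
  have "graph_dist G x y \<le> 2"
    using graph_dist_le[OF p] by simp
  moreover have "graph_dist G x y \<noteq> 0" "graph_dist G x y \<noteq> 1"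
    using graph_dist_eq_0D[OF p] graph_dist_eq_1D[OF p] assms by auto
  ultimately show ?thesis by linarith
qed

end

section \<open>Distances and resolving sets in complete multipartite graphs\<close>

text \<open>The partition whose existence \<open>complete_multipartite\<close> asserts becomes a
  parameter, and any finite index set may label the parts.\<close>

locale multipartite = pair_graph G for G :: "'a pair_pre_digraph" +
  fixes I :: "'i set" and a :: "'i \<Rightarrow> nat" and P :: "'i \<Rightarrow> 'a set"
  assumes finite_index: "finite I"
    and card_index: "2 \<le> card I"
    and verts_eq: "pverts G = (\<Union>i\<in>I. P i)"
    and disjoint: "disjoint_family_on P I"
    and part_size_pos: "\<And>i. i \<in> I \<Longrightarrow> 1 \<le> a i"
    and card_part: "\<And>i. i \<in> I \<Longrightarrow> card (P i) = a i"
    and arcs_eq: "parcs G = {(u, v). \<exists>i\<in>I. \<exists>j\<in>I. i \<noteq> j \<and> u \<in> P i \<and> v \<in> P j}"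
begin

lemma part_unique: "i \<in> I \<Longrightarrow> j \<in> I \<Longrightarrow> x \<in> P i \<Longrightarrow> x \<in> P j \<Longrightarrow> i = j"
  using disjoint unfolding disjoint_family_on_def by blast

text \<open>An infinite set has \<open>card\<close> 0, so positive size forces finiteness.\<close>

lemma finite_part: "i \<in> I \<Longrightarrow> finite (P i)"
  using card_part part_size_pos by (intro card_ge_0_finite) fastforce

lemma arc_iff:
  assumes "i \<in> I" "j \<in> I" "x \<in> P i" "y \<in> P j"
  shows "(x, y) \<in> parcs G \<longleftrightarrow> i \<noteq> j"
  using assms part_unique unfolding arcs_eq by blast

lemma dist_distinct_parts:
  assumes "i \<in> I" "j \<in> I" "i \<noteq> j" "x \<in> P i" "y \<in> P j"
  shows "graph_dist G x y = 1"
  using assms part_unique[of i j x] by (intro graph_dist_adjacent) (auto simp: arc_iff)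

text \<open>Any vertex of another part is a common neighbour; one exists because there are at least
  two parts and none is empty.\<close>

lemma dist_same_part:
  assumes "i \<in> I" "x \<in> P i" "y \<in> P i" "x \<noteq> y"
  shows "graph_dist G x y = 2"
proof -
  have "0 < card (I - {i})"
    using card_index finite_index assms(1) by simp
  then obtain j where j: "j \<in> I" "j \<noteq> i"
    by (auto simp: card_gt_0_iff)
  then have "P j \<noteq> {}"
    using card_part[of j] part_size_pos[of j] by auto
  then obtain z where "z \<in> P j" by blast
  with assms j show ?thesis
    using part_unique[of i j z]
    by (intro graph_dist_common_neighbour[of x z]) (auto simp: arc_iff[of i j]
      arc_iff[of j i] arc_iff[of i i])
qed

text \<open>A third vertex sees both at distance 2 (same part) or both at distance 1 (other part),
  whereas \<open>x\<close> and \<open>y\<close> each see the distances 0 and 2.\<close>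

lemma resolving_set_same_part:
  assumes "i \<in> I" "x \<in> P i" "y \<in> P i" "x \<noteq> y"
  shows "resolving_set G x y = {x, y}"
proof -
  have verts: "x \<in> pverts G" "y \<in> pverts G"
    using assms by (auto simp: verts_eq)
  have "graph_dist G x z = graph_dist G y z" if "z \<in> pverts G" "z \<noteq> x" "z \<noteq> y" for z
  proof -
    obtain j where "j \<in> I" "z \<in> P j"
      using \<open>z \<in> pverts G\<close> by (auto simp: verts_eq)
    with assms that show ?thesis
      by (cases "j = i") (simp_all add: dist_same_part[of i] dist_distinct_parts[of i j])
  qed
  moreover have "graph_dist G x y = 2" "graph_dist G y x = 2"
    using assms by (auto intro: dist_same_part[of i])
  ultimately show ?thesis
    using verts by (auto simp: resolving_set_def graph_dist_self)
qed

text \<open>Distances inside a part are 0 or 2, never the value 1 taken across parts. So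
  \<open>z\<close> separates \<open>x\<close> from \<open>y\<close> exactly when it shares a part
  with one of them.\<close>

lemma resolving_set_distinct_parts:
  assumes "i \<in> I" "j \<in> I" "i \<noteq> j" "x \<in> P i" "y \<in> P j"
  shows "resolving_set G x y = P i \<union> P j"
proof -
  have "graph_dist G x z \<noteq> graph_dist G y z \<longleftrightarrow> z \<in> P i \<union> P j" if "z \<in> pverts G" for z
  proof -
    obtain l where l: "l \<in> I" "z \<in> P l"
      using \<open>z \<in> pverts G\<close> by (auto simp: verts_eq)
    have dist: "graph_dist G u z = (if l \<noteq> h then 1 else if u = z then 0 else 2)"
      if "h \<in> I" "u \<in> P h" for u h
      using that l graph_dist_self[of u G] dist_same_part[of h u z]
        dist_distinct_parts[of h l u z] by (auto simp: verts_eq)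
    have "z \<in> P i \<union> P j \<longleftrightarrow> l = i \<or> l = j"
      using l assms part_unique by blast
    with dist[of i x] dist[of j y] assms show ?thesis
      by auto
  qed
  moreover have "P i \<union> P j \<subseteq> pverts G"
    using assms by (auto simp: verts_eq)
  ultimately show ?thesis
    unfolding resolving_set_def by blast
qed

section \<open>Sums over parts and the admissible range of \<open>k\<close>\<close>

lemma sum_verts:
  fixes g :: "'a \<Rightarrow> real"
  shows "sum g (pverts G) = (\<Sum>i\<in>I. sum g (P i))"
  unfolding verts_eq using finite_part disjoint
  by (intro sum.UNION_disjoint) (auto simp: disjoint_family_on_def finite_index)

lemma sum_resolving_distinct_parts:
  fixes g :: "'a \<Rightarrow> real"
  assumes "i \<in> I" "j \<in> I" "i \<noteq> j" "x \<in> P i" "y \<in> P j"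
  shows "sum g (resolving_set G x y) = sum g (P i) + sum g (P j)"
  using assms finite_part disjoint
  by (simp add: resolving_set_distinct_parts sum.union_disjoint disjoint_family_on_def)

lemma exists_distinct_vertices: "\<exists>x\<in>pverts G. \<exists>y\<in>pverts G. x \<noteq> y"
proof -
  obtain i j where ij: "i \<in> I" "j \<in> I" "i \<noteq> j"
    using card_index by (auto simp: card_le_Suc_iff numeral_2_eq_2)
  then have "P i \<noteq> {}" "P j \<noteq> {}"
    using card_part part_size_pos by fastforce+
  then obtain x y where "x \<in> P i" "y \<in> P j" by blast
  with ij part_unique[of i j x] show ?thesis
    by (force simp: verts_eq)
qed

text \<open>Two distinct vertices always belong to their own resolving set. This makes every
  \<open>k\<close> in [1, 2] admissible in \<open>k_resolving\<close>.\<close>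

lemma two_le_kappa: "2 \<le> kappa G"
proof -
  let ?S = "{card (resolving_set G x y) | x y. x \<in> pverts G \<and> y \<in> pverts G \<and> x \<noteq> y}"
  \<comment> \<open>\<open>Min\<close> is meaningful only on a finite nonempty set; finiteness comes
    from viewing \<open>?S\<close> inside an image of vertex pairs.\<close>
  have "?S \<subseteq> (\<lambda>(x, y). card (resolving_set G x y)) ` (pverts G \<times> pverts G)"
    by auto
  then have fin: "finite ?S"
    by (rule finite_subset) (simp add: pair_finite_verts)
  have "2 \<le> card (resolving_set G x y)" if "x \<in> pverts G" "y \<in> pverts G" "x \<noteq> y" for x y
  proof -
    obtain i j where ij: "i \<in> I" "x \<in> P i" "j \<in> I" "y \<in> P j"
      using \<open>x \<in> pverts G\<close> \<open>y \<in> pverts G\<close> by (auto simp: verts_eq)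
    have "{x, y} \<subseteq> resolving_set G x y"
      using ij \<open>x \<noteq> y\<close>
      by (cases "i = j") (simp_all add: resolving_set_same_part resolving_set_distinct_parts[of i j])
    moreover have "finite (resolving_set G x y)"
      by (simp add: resolving_set_def pair_finite_verts)
    ultimately have "card {x, y} \<le> card (resolving_set G x y)"
      by (rule card_mono[rotated])
    with \<open>x \<noteq> y\<close> show ?thesis by simp
  qed
  moreover have "?S \<noteq> {}"
    using exists_distinct_vertices by blast
  ultimately show ?thesis
    unfolding kappa_def using fin by (subst Min_ge_iff) auto
qed

section \<open>Lower bound for the total weight\<close>

definition singletons :: "'i set" where
  "singletons = {i \<in> I. a i = 1}"

text \<open>The number of vertices that must carry weight \<open>k / 2\<close> on average. The
  natural subtraction is exact, as 1 is removed only when a part of size 1 contributes to the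
  sum.\<close>

definition required_order :: nat where
  "required_order = (\<Sum>i\<in>I. a i) - (if card singletons = 1 then 1 else 0)"

lemma order_split:
  "(\<Sum>i\<in>I. a i) = (\<Sum>i\<in>I - singletons. a i) + card singletons"
proof -
  have "(\<Sum>i\<in>I. a i) = (\<Sum>i\<in>I - singletons. a i) + (\<Sum>i\<in>singletons. a i)"
    by (rule sum.subset_diff) (auto simp: singletons_def finite_index)
  then show ?thesis by (simp add: singletons_def)
qed

lemma required_order_split:
  "required_order =
     (\<Sum>i\<in>I - singletons. a i) + (if card singletons = 1 then 0 else card singletons)"
  by (simp add: required_order_def order_split)

lemma k_resolving_lower_bound:
  assumes g: "k_resolving G k g"
  shows "k * real required_order / 2 \<le> sum g (pverts G)"
proof -
  have resolves: "k \<le> sum g (resolving_set G x y)"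
    if "x \<in> pverts G" "y \<in> pverts G" "x \<noteq> y" for x y
    using g that by (auto simp: k_resolving_def)
  have big: "k * real (a i) / 2 \<le> sum g (P i)" if "i \<in> I - singletons" for i
  proof -
    have i: "i \<in> I" "card (P i) \<noteq> 1"
      using that card_part by (auto simp: singletons_def)
    have "k \<le> g x + g y" if "x \<in> P i" "y \<in> P i" "x \<noteq> y" for x y
      using resolves[of x y] i(1) that
      by (auto simp: resolving_set_same_part[of i] verts_eq)
    from sum_lower_bound_if_pairwise[OF finite_part[OF i(1)] i(2) this] show ?thesis
      using card_part[OF i(1)] by simp
  qed
  \<comment> \<open>With a unique singleton part there is no pair to average over, and only
    nonnegativity remains.\<close>
  have small: "k * real (if card singletons = 1 then 0 else card singletons) / 2
      \<le> (\<Sum>i\<in>singletons. sum g (P i))"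
  proof (cases "card singletons = 1")
    case True
    have "0 \<le> g x" if "x \<in> P i" "i \<in> singletons" for x i
      using g that by (auto simp: k_resolving_def verts_eq singletons_def)
    with True show ?thesis by (auto intro!: sum_nonneg)
  next
    case False
    have "k \<le> sum g (P i) + sum g (P j)"
      if "i \<in> singletons" "j \<in> singletons" "i \<noteq> j" for i j
    proof -
      have ij: "i \<in> I" "j \<in> I" "P i \<noteq> {}" "P j \<noteq> {}"
        using that card_part by (fastforce simp: singletons_def)+
      then obtain x y where "x \<in> P i" "y \<in> P j" by blast
      with ij \<open>i \<noteq> j\<close> part_unique[of i j x] show ?thesis
        using resolves[of x y] sum_resolving_distinct_parts[of i j x y g]
        by (auto simp: verts_eq)
    qed
    \<comment> \<open>The averaging runs over indices here, each singleton part counting as one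
      element; the case of no singleton part is included.\<close>
    with False show ?thesis
      using sum_lower_bound_if_pairwise[of singletons k "\<lambda>i. sum g (P i)"]
      by (simp add: singletons_def finite_index)
  qed
  have "k * real required_order / 2 = (\<Sum>i\<in>I - singletons. k * real (a i) / 2)
      + k * real (if card singletons = 1 then 0 else card singletons) / 2"
    unfolding required_order_split
    by (simp add: algebra_simps add_divide_distrib flip: sum_distrib_left sum_divide_distrib)
  also have "\<dots> \<le> (\<Sum>i\<in>I - singletons. sum g (P i)) + (\<Sum>i\<in>singletons. sum g (P i))"
    using big small by (intro add_mono sum_mono)
  also have "\<dots> = (\<Sum>i\<in>I. sum g (P i))"
    by (rule sum.subset_diff[symmetric]) (auto simp: singletons_def finite_index)
  finally show ?thesis by (simp add: sum_verts)
qed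

section \<open>An optimal resolving function\<close>

text \<open>The vertex of a unique singleton part can get weight 0: every pair containing it is also
  resolved by a whole part of at least two vertices, of weight at least \<open>k\<close>.\<close>

definition optimal_weight :: "real \<Rightarrow> 'a \<Rightarrow> real" where
  "optimal_weight k v = (if card singletons = 1 \<and> v \<in> (\<Union>i\<in>singletons. P i) then 0 else k / 2)"

lemma optimal_weight_part:
  assumes "i \<in> I" "v \<in> P i"
  shows "optimal_weight k v = (if card singletons = 1 \<and> i \<in> singletons then 0 else k / 2)"
proof -
  have "v \<in> (\<Union>i\<in>singletons. P i) \<longleftrightarrow> i \<in> singletons"
    using assms part_unique unfolding singletons_def by blast
  then show ?thesis
    by (simp only: optimal_weight_def)
qed

lemma sum_optimal_weight_part:
  assumes "i \<in> I"
  shows "sum (optimal_weight k) (P i)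
    = (if card singletons = 1 \<and> i \<in> singletons then 0 else k * real (a i) / 2)"
proof -
  have "sum (optimal_weight k) (P i)
      = (\<Sum>v\<in>P i. if card singletons = 1 \<and> i \<in> singletons then 0 else k / 2)"
    using assms by (intro sum.cong refl optimal_weight_part)
  then show ?thesis
    using card_part[OF assms] by simp
qed

lemma sum_optimal_weight: "sum (optimal_weight k) (pverts G) = k * real required_order / 2"
proof -
  let ?f = "\<lambda>i. if card singletons = 1 \<and> i \<in> singletons then 0 else k * real (a i) / 2"
  have "sum (optimal_weight k) (pverts G) = sum ?f I"
    unfolding sum_verts by (intro sum.cong refl sum_optimal_weight_part)
  also have "\<dots> = sum ?f (I - singletons) + sum ?f singletons"
    by (rule sum.subset_diff) (auto simp: singletons_def finite_index)
  also have "sum ?f (I - singletons) = (\<Sum>i\<in>I - singletons. k * real (a i) / 2)"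
    by (rule sum.cong) auto
  also have "sum ?f singletons
      = (\<Sum>i\<in>singletons. if card singletons = 1 then 0 else k / 2)"
    by (rule sum.cong) (auto simp: singletons_def)
  finally show ?thesis
    unfolding required_order_split
    by (simp add: algebra_simps add_divide_distrib flip: sum_distrib_left sum_divide_distrib)
qed

text \<open>The bound \<open>k \<le> 2\<close> serves twice: it keeps the value \<open>k / 2\<close>
  at most 1, and it keeps \<open>k\<close> at most \<open>kappa G\<close>.\<close>

lemma k_resolving_optimal_weight:
  assumes "1 \<le> k" "k \<le> 2"
  shows "k_resolving G k (optimal_weight k)"
  unfolding k_resolving_def
proof (intro conjI ballI impI)
  show "k \<le> real (kappa G)"
    using two_le_kappa assms by linarith
next
  fix x y assume xy: "x \<in> pverts G" "y \<in> pverts G" "x \<noteq> y"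
  then obtain i j where ij: "i \<in> I" "x \<in> P i" "j \<in> I" "y \<in> P j"
    by (auto simp: verts_eq)
  show "k \<le> sum (optimal_weight k) (resolving_set G x y)"
  proof (cases "i = j")
    case True
    then have "card {x, y} \<le> card (P i)"
      using ij by (intro card_mono finite_part) auto
    then have "i \<notin> singletons"
      using xy(3) card_part[OF ij(1)] by (auto simp: singletons_def)
    then have "optimal_weight k x = k / 2" "optimal_weight k y = k / 2"
      using True ij by (simp_all add: optimal_weight_part[of i])
    moreover have "resolving_set G x y = {x, y}"
      using True ij xy(3) by (simp add: resolving_set_same_part[of i])
    ultimately show ?thesis
      using xy(3) by simp
  next
    case False
    have eq: "sum (optimal_weight k) (resolving_set G x y)
        = sum (optimal_weight k) (P i) + sum (optimal_weight k) (P j)"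
      using False ij by (intro sum_resolving_distinct_parts)
    have nonneg: "0 \<le> sum (optimal_weight k) (P l)" for l
      using assms by (intro sum_nonneg) (simp add: optimal_weight_def)
    \<comment> \<open>Two ways to reach \<open>k\<close>: two parts of weight at least
      \<open>k / 2\<close> each, or a single part with two or more vertices. The second is needed
      when a unique singleton part has weight 0.\<close>
    have half: "k / 2 \<le> sum (optimal_weight k) (P l)"
      if "l \<in> I" "card singletons \<noteq> 1" for l
    proof -
      have "k * 1 \<le> k * real (a l)"
        using part_size_pos[OF that(1)] assms by (intro mult_left_mono) auto
      then show ?thesis
        unfolding sum_optimal_weight_part[OF that(1)] using that(2)
        by (simp only: if_False simp_thms)
    qed
    have full: "k \<le> sum (optimal_weight k) (P l)" if "l \<in> I" "l \<notin> singletons" for l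
    proof -
      have "2 \<le> a l"
        using that part_size_pos[of l] by (simp add: singletons_def)
      then have "k * 2 \<le> k * real (a l)"
        using assms by (intro mult_left_mono) auto
      then show ?thesis
        unfolding sum_optimal_weight_part[OF that(1)] using that(2)
        by (simp only: if_False simp_thms)
    qed
    show ?thesis
    proof (cases "card singletons = 1")
      case True
      then have "i \<notin> singletons \<or> j \<notin> singletons"
        using \<open>i \<noteq> j\<close> by (metis card_1_singletonE singletonD)
      then show ?thesis
        unfolding eq using full ij(1,3) nonneg[of i] nonneg[of j] by force
    next
      case False
      show ?thesis
        unfolding eq using half[OF ij(1) False] half[OF ij(3) False] by linarith
    qed
  qed
qed (use assms in \<open>simp_all add: optimal_weight_def\<close>)

section \<open>The minimum and the closed formula\<close>

lemma frac_k_metric_dim_eq: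
  assumes "1 \<le> k" "k \<le> 2"
  shows "frac_k_metric_dim k G = k * real required_order / 2"
  unfolding frac_k_metric_dim_def
proof (rule Least_equality)
  show "\<exists>g. k_resolving G k g \<and> k * real required_order / 2 = sum g (pverts G)"
    using k_resolving_optimal_weight[OF assms] sum_optimal_weight[of k] by metis
qed (metis k_resolving_lower_bound)

end

theorem proposition4p12:
  fixes G :: "'a pair_pre_digraph" and a :: "nat \<Rightarrow> nat" and m n s :: nat and k :: real
  assumes "2 \<le> m"
    and "complete_multipartite m a G"
    and "n = (\<Sum>i=1..m. a i)" and "3 \<le> n"
    and "s = card {i \<in> {1..m}. a i = 1}"
    and "1 \<le> k" and "k \<le> 2"
  shows "frac_k_metric_dim k G = k * frac_metric_dim G \<and>
    k * frac_metric_dim G = (if s = 1 then k * (real n - 1) / 2 else k * real n / 2)"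
proof -
  obtain P where "pair_graph G" "pverts G = (\<Union>i\<in>{1..m}. P i)" "disjoint_family_on P {1..m}"
    "\<forall>i\<in>{1..m}. 1 \<le> a i \<and> card (P i) = a i"
    "parcs G = {(u, v). \<exists>i\<in>{1..m}. \<exists>j\<in>{1..m}. i \<noteq> j \<and> u \<in> P i \<and> v \<in> P j}"
    using assms(2) unfolding complete_multipartite_def by blast
  then interpret multipartite G "{1..m}" a P
    using assms(1) by (simp add: multipartite_def multipartite_axioms_def)
  have "real required_order = (if s = 1 then real n - 1 else real n)"
    unfolding required_order_def singletons_def assms(3)[symmetric] assms(5)[symmetric]
    using assms(4) by (simp add: of_nat_diff)
  \<comment> \<open>This is the case \<open>k = 1\<close>; as the formula is linear in
    \<open>k\<close>, the first equation of the theorem follows.\<close>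
  moreover have "frac_metric_dim G = real required_order / 2"
    using frac_k_metric_dim_eq[of 1] unfolding frac_metric_dim_def by linarith
  ultimately show ?thesis
    unfolding frac_k_metric_dim_eq[OF assms(6,7)] by (simp split: if_split)
qed

end
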